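(* Let $(A,\mu,\alpha,\beta)$ be a BiHom-associative superalgebra over a field $k$, with $\mu(a\otimes b)=ab$, such that $\alpha$ and $\beta$ are bijective. Define a bracket on homogeneous elements $x,y\in A$ by $$[x,y]=xy-(-1)^{|x||y|}\,\alpha^{-1}(\beta(y))\,\alpha(\beta^{-1}(x))$$ and extend it bilinearly to all of $A$. Then $(A,[\cdot,\cdot],\alpha,\beta)$ is a BiHom-Lie superalgebra.
   Context: All spaces are over a field $k$. A superspace is a $\mathbb{Z}_2$-graded vector space $V=V_0\oplus V_1$; elements of $V_j$ are homogeneous of parity $j$, and the parity of a homogeneous $x$ is denoted $|x|$. A linear map between superspaces is even if it preserves the grading; a bilinear map $V\otimes V\to V$ is even if it maps $V_i\otimes V_j$ to $V_{i+j}$ (indices mod 2). A BiHom-associative superalgebra is a 4-tuple $(A,\mu,\alpha,\beta)$ where $A$ is a superspace, $\alpha,\beta:A\to A$ are even linear maps and $\mu:A\otimes A\to A$, $\mu(a\otimes b)=ab$, is an even bilinear map such that for all homogeneous $a,b,c\in A$: $\alpha\circ\beta=\beta\circ\alpha$; $\alpha(ab)=\alpha(a)\alpha(b)$ and $\beta(ab)=\beta(a)\beta(b)$; $\alpha(a)(bc)=(ab)\beta(c)$. A BiHom-Lie superalgebra is a 4-tuple $(L,[\cdot,\cdot],\alpha,\beta)$ where $L$ is a superspace, $\alpha,\beta:L\to L$ are even linear maps and $[\cdot,\cdot]:L\otimes L\to L$ is an even bilinear map such that for all homogeneous $x,y,z\in L$: $\alpha\circ\beta=\beta\circ\alpha$;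 $\alpha[x,y]=[\alpha(x),\alpha(y)]$ and $\beta[x,y]=[\beta(x),\beta(y)]$; $[\beta(x),\alpha(y)]=-(-1)^{|x||y|}[\beta(y),\alpha(x)]$; and $$\circlearrowleft_{x,y,z}(-1)^{|x||z|}[\beta^{2}(x),[\beta(y),\alpha(z)]]=0,$$ where $\circlearrowleft_{x,y,z}$ denotes the sum over the cyclic permutations of $(x,y,z)$, i.e. the left side is $(-1)^{|x||z|}[\beta^{2}(x),[\beta(y),\alpha(z)]]+(-1)^{|y||x|}[\beta^{2}(y),[\beta(z),\alpha(x)]]+(-1)^{|z||y|}[\beta^{2}(z),[\beta(x),\alpha(y)]]$. *)

theory Defs
  imports Complex_Main "HOL-Library.Z2"
begin

text \<open>Parities live in the field \<open>bit\<close> with two elements, so index arithmetic is modulo 2.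
  The zero vector is homogeneous of both parities.\<close>

locale superspace = vector_space scale
  for scale :: "'k::field \<Rightarrow> 'v::ab_group_add \<Rightarrow> 'v" +
  fixes V :: "bit \<Rightarrow> 'v set"
  assumes subspace_part: "\<And>i. subspace (V i)"
    and parts_disjoint: "V 0 \<inter> V 1 = {0}"
    and parts_span: "\<And>x. \<exists>a\<in>V 0. \<exists>b\<in>V 1. x = a + b"

definition even_linear ::
    "('k::field \<Rightarrow> 'v::ab_group_add \<Rightarrow> 'v) \<Rightarrow> (bit \<Rightarrow> 'v set) \<Rightarrow> ('v \<Rightarrow> 'v) \<Rightarrow> bool"
  where "even_linear scale V f \<longleftrightarrow>
    Vector_Spaces.linear scale scale f \<and> (\<forall>i. \<forall>x\<in>V i. f x \<in> V i)"

definition bilinear_op ::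
    "('k::field \<Rightarrow> 'v::ab_group_add \<Rightarrow> 'v) \<Rightarrow> ('v \<Rightarrow> 'v \<Rightarrow> 'v) \<Rightarrow> bool"
  where "bilinear_op scale m \<longleftrightarrow>
    (\<forall>x. Vector_Spaces.linear scale scale (\<lambda>y. m x y)) \<and>
    (\<forall>y. Vector_Spaces.linear scale scale (\<lambda>x. m x y))"

definition even_bilinear ::
    "('k::field \<Rightarrow> 'v::ab_group_add \<Rightarrow> 'v) \<Rightarrow> (bit \<Rightarrow> 'v set) \<Rightarrow> ('v \<Rightarrow> 'v \<Rightarrow> 'v) \<Rightarrow> bool"
  where "even_bilinear scale V m \<longleftrightarrow>
    bilinear_op scale m \<and> (\<forall>i j. \<forall>x\<in>V i. \<forall>y\<in>V j. m x y \<in> V (i + j))"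

text \<open>\<open>sgn_parity i\<close> is $(-1)^i$ in the ground field; the product \<open>i * j\<close> of parities gives
  the sign $(-1)^{ij}$.\<close>

definition sgn_parity :: "bit \<Rightarrow> 'k::field"
  where "sgn_parity i = (if i = 0 then 1 else - 1)"

locale bihom_superalgebra = superspace scale V
  for scale :: "'k::field \<Rightarrow> 'v::ab_group_add \<Rightarrow> 'v" and V :: "bit \<Rightarrow> 'v set" +
  fixes m :: "'v \<Rightarrow> 'v \<Rightarrow> 'v" and \<alpha> \<beta> :: "'v \<Rightarrow> 'v"
  assumes even_\<alpha>: "even_linear scale V \<alpha>"
    and even_\<beta>: "even_linear scale V \<beta>"
    and even_m: "even_bilinear scale V m"
    and commute: "\<alpha> \<circ> \<beta> = \<beta> \<circ> \<alpha>"
    and \<alpha>_mult: "\<And>i j x y. x \<in> V i \<Longrightarrow> y \<in> V j \<Longrightarrow> \<alpha> (m x y) = m (\<alpha> x) (\<alpha> y)"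
    and \<beta>_mult: "\<And>i j x y. x \<in> V i \<Longrightarrow> y \<in> V j \<Longrightarrow> \<beta> (m x y) = m (\<beta> x) (\<beta> y)"

locale bihom_associative_superalgebra = bihom_superalgebra scale V m \<alpha> \<beta>
  for scale :: "'k::field \<Rightarrow> 'v::ab_group_add \<Rightarrow> 'v" and V :: "bit \<Rightarrow> 'v set"
    and m :: "'v \<Rightarrow> 'v \<Rightarrow> 'v" and \<alpha> \<beta> :: "'v \<Rightarrow> 'v" +
  assumes bihom_assoc:
    "\<And>i j l a b c. a \<in> V i \<Longrightarrow> b \<in> V j \<Longrightarrow> c \<in> V l \<Longrightarrow> m (\<alpha> a) (m b c) = m (m a b) (\<beta> c)"

locale bihom_lie_superalgebra = bihom_superalgebra scale V br \<alpha> \<beta>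
  for scale :: "'k::field \<Rightarrow> 'v::ab_group_add \<Rightarrow> 'v" and V :: "bit \<Rightarrow> 'v set"
    and br :: "'v \<Rightarrow> 'v \<Rightarrow> 'v" and \<alpha> \<beta> :: "'v \<Rightarrow> 'v" +
  assumes bihom_skew:
    "\<And>i j x y. x \<in> V i \<Longrightarrow> y \<in> V j \<Longrightarrow>
      br (\<beta> x) (\<alpha> y) = - scale (sgn_parity (i * j)) (br (\<beta> y) (\<alpha> x))"
    and bihom_jacobi:
    "\<And>i j l x y z. x \<in> V i \<Longrightarrow> y \<in> V j \<Longrightarrow> z \<in> V l \<Longrightarrow>
      scale (sgn_parity (i * l)) (br (\<beta> (\<beta> x)) (br (\<beta> y) (\<alpha> z))) +
      scale (sgn_parity (j * i)) (br (\<beta> (\<beta> y)) (br (\<beta> z) (\<alpha> x))) +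
      scale (sgn_parity (l * j)) (br (\<beta> (\<beta> z)) (br (\<beta> x) (\<alpha> y))) = 0"

text \<open>The component of parity \<open>i\<close>; \<open>i + 1\<close> is the opposite parity.\<close>

definition homog_part :: "(bit \<Rightarrow> 'v::ab_group_add set) \<Rightarrow> bit \<Rightarrow> 'v \<Rightarrow> 'v"
  where "homog_part V i x = (THE u. u \<in> V i \<and> x - u \<in> V (i + 1))"

text \<open>The bilinear extension of
  $[x,y] = xy - (-1)^{|x||y|}\alpha^{-1}(\beta(y))\,\alpha(\beta^{-1}(x))$ from homogeneous elements:
  sum the formula over the homogeneous components of both arguments. The lemmas below show that
  it is the only bilinear map given by that formula on homogeneous elements.\<close>

definition bihom_bracket ::
    "('k::field \<Rightarrow> 'v::ab_group_add \<Rightarrow> 'v) \<Rightarrow> (bit \<Rightarrow> 'v set) \<Rightarrow> ('v \<Rightarrow> 'v \<Rightarrow> 'v) \<Rightarrow>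
      ('v \<Rightarrow> 'v) \<Rightarrow> ('v \<Rightarrow> 'v) \<Rightarrow> 'v \<Rightarrow> 'v \<Rightarrow> 'v"
  where "bihom_bracket scale V m \<alpha> \<beta> x y =
    (\<Sum>i\<in>{0, 1}. \<Sum>j\<in>{0, 1}.
      let u = homog_part V i x; v = homog_part V j y in
      m u v - scale (sgn_parity (i * j)) (m (inv \<alpha> (\<beta> v)) (\<alpha> (inv \<beta> u))))"

context superspace
begin

lemma linear_iff_rules:
  "Vector_Spaces.linear scale scale f \<longleftrightarrow>
    (\<forall>x y. f (x + y) = f x + f y) \<and> (\<forall>c x. f (scale c x) = scale c (f x))"
  using vector_space_axioms by (simp add: Vector_Spaces.linear_iff)

lemma homog_part_eqI:
  assumes "u \<in> V i" "x - u \<in> V (i + 1)"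
  shows "homog_part V i x = u"
  unfolding homog_part_def
proof (rule the_equality)
  fix w assume w: "w \<in> V i \<and> x - w \<in> V (i + 1)"
  have "w - u \<in> V i"
    using w assms subspace_diff[OF subspace_part] by blast
  moreover have "w - u \<in> V (i + 1)"
    using subspace_diff[OF subspace_part assms(2), of "x - w"] w by simp
  ultimately have "w - u \<in> V 0 \<inter> V 1" by (cases i) auto
  then show "w = u" using parts_disjoint by simp
qed (use assms in blast)

lemma homog_part_spec: "homog_part V i x \<in> V i" "x - homog_part V i x \<in> V (i + 1)"
proof -
  obtain a b where ab: "a \<in> V 0" "b \<in> V 1" "x = a + b" using parts_span by blast
  have "\<exists>u. u \<in> V i \<and> x - u \<in> V (i + 1)"
    by (cases i) (use ab in \<open>auto intro: exI[of _ a] exI[of _ b]\<close>)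
  then show "homog_part V i x \<in> V i" "x - homog_part V i x \<in> V (i + 1)"
    using homog_part_eqI by metis+
qed

lemma homog_part_homog:
  assumes "x \<in> V j"
  shows "homog_part V i x = (if i = j then x else 0)"
proof (cases "i = j")
  case True
  then show ?thesis
    using assms subspace_0[OF subspace_part] by (auto intro!: homog_part_eqI)
next
  case False
  then have "j = i + 1" by (cases i; cases j) auto
  then show ?thesis
    using assms False subspace_0[OF subspace_part] by (auto intro!: homog_part_eqI)
qed

lemma homog_part_sum: "homog_part V 0 x + homog_part V 1 x = x"
proof -
  have "homog_part V 1 x = x - homog_part V 0 x"
    using homog_part_spec[where i = 0 and x = x] by (intro homog_part_eqI) auto
  then show ?thesis by simp
qed

lemma linear_homog_part: "Vector_Spaces.linear scale scale (homog_part V i)"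
  unfolding linear_iff_rules
proof (intro conjI allI)
  show "homog_part V i (x + y) = homog_part V i x + homog_part V i y" for x y
  proof (rule homog_part_eqI)
    show "homog_part V i x + homog_part V i y \<in> V i"
      using homog_part_spec subspace_add[OF subspace_part] by blast
    show "x + y - (homog_part V i x + homog_part V i y) \<in> V (i + 1)"
      using subspace_add[OF subspace_part homog_part_spec(2) homog_part_spec(2), of x i y]
      by (simp add: algebra_simps)
  qed
  show "homog_part V i (scale c x) = scale c (homog_part V i x)" for c x
  proof (rule homog_part_eqI)
    show "scale c (homog_part V i x) \<in> V i"
      using homog_part_spec subspace_scale[OF subspace_part] by blast
    show "scale c x - scale c (homog_part V i x) \<in> V (i + 1)"
      using subspace_scale[OF subspace_part homog_part_spec(2), of c x i]
      by (simp add: scale_right_diff_distrib)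
  qed
qed

end

context bihom_superalgebra
begin

lemma linear_inv:
  assumes f: "Vector_Spaces.linear scale scale f" and "bij f"
  shows "Vector_Spaces.linear scale scale (inv f)"
proof -
  have *: "f (inv f x) = x" for x using assms(2) by (simp add: bij_is_surj surj_f_inv_f)
  have **: "inv f (f x) = x" for x using assms(2) by (simp add: bij_is_inj)
  show ?thesis
    using f unfolding linear_iff_rules by (metis * **)
qed

lemma bihom_bracket_bilinear:
  assumes "bij \<alpha>" "bij \<beta>"
  shows "bilinear_op scale (bihom_bracket scale V m \<alpha> \<beta>)"
proof -
  have lin: "Vector_Spaces.linear scale scale \<alpha>" "Vector_Spaces.linear scale scale \<beta>"
    using even_\<alpha> even_\<beta> by (auto simp: even_linear_def)
  note inv = linear_inv[OF lin(1) assms(1)] linear_inv[OF lin(2) assms(2)]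
  have m: "\<And>x. Vector_Spaces.linear scale scale (\<lambda>y. m x y)"
    "\<And>y. Vector_Spaces.linear scale scale (\<lambda>x. m x y)"
    using even_m by (auto simp: even_bilinear_def bilinear_op_def)
  have h: "Vector_Spaces.linear scale scale (homog_part V i)" for i by (rule linear_homog_part)
  show ?thesis
    using lin inv m h
    unfolding bilinear_op_def linear_iff_rules bihom_bracket_def Let_def
    by (simp add: scale_right_distrib scale_right_diff_distrib algebra_simps)
qed

lemma bihom_bracket_homog:
  assumes "bij \<alpha>" "bij \<beta>" "x \<in> V i" "y \<in> V j"
  shows "bihom_bracket scale V m \<alpha> \<beta> x y =
    m x y - scale (sgn_parity (i * j)) (m (inv \<alpha> (\<beta> y)) (\<alpha> (inv \<beta> x)))"
proof -
  have lin: "Vector_Spaces.linear scale scale \<alpha>" "Vector_Spaces.linear scale scale \<beta>"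
    using even_\<alpha> even_\<beta> by (auto simp: even_linear_def)
  note inv = linear_inv[OF lin(1) assms(1)] linear_inv[OF lin(2) assms(2)]
  have m: "m x 0 = 0" "m 0 x = 0" for x
    using even_m unfolding even_bilinear_def bilinear_op_def linear_iff_rules
    by (metis scale_zero_left)+
  have z: "\<alpha> 0 = 0" "\<beta> 0 = 0" "inv \<alpha> 0 = 0" "inv \<beta> 0 = 0"
    using lin inv unfolding linear_iff_rules by (metis scale_zero_left)+
  show ?thesis
    unfolding bihom_bracket_def Let_def homog_part_homog[OF assms(3)] homog_part_homog[OF assms(4)]
    by (cases i; cases j) (simp_all add: m z)
qed

lemma bihom_bracket_unique:
  assumes "bij \<alpha>" "bij \<beta>" and br: "bilinear_op scale br"
    and "\<And>i j x y. x \<in> V i \<Longrightarrow> y \<in> V j \<Longrightarrow>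
      br x y = m x y - scale (sgn_parity (i * j)) (m (inv \<alpha> (\<beta> y)) (\<alpha> (inv \<beta> x)))"
  shows "br = bihom_bracket scale V m \<alpha> \<beta>"
proof (intro ext)
  fix x y
  have expand: "f x y = f (homog_part V 0 x) (homog_part V 0 y)
    + f (homog_part V 0 x) (homog_part V 1 y)
    + (f (homog_part V 1 x) (homog_part V 0 y) + f (homog_part V 1 x) (homog_part V 1 y))"
    if "bilinear_op scale f" for f
  proof -
    have "f x y = f (homog_part V 0 x + homog_part V 1 x)
        (homog_part V 0 y + homog_part V 1 y)"
      by (simp only: homog_part_sum)
    also have "\<dots> = f (homog_part V 0 x) (homog_part V 0 y) + f (homog_part V 0 x) (homog_part V 1 y)
      + (f (homog_part V 1 x) (homog_part V 0 y) + f (homog_part V 1 x) (homog_part V 1 y))"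
      using that unfolding bilinear_op_def linear_iff_rules by (simp add: add_ac)
    finally show ?thesis .
  qed
  have "br (homog_part V i x) (homog_part V j y)
      = bihom_bracket scale V m \<alpha> \<beta> (homog_part V i x) (homog_part V j y)" for i j
    using assms(4)[OF homog_part_spec(1) homog_part_spec(1), of i x j y]
      bihom_bracket_homog[OF assms(1,2) homog_part_spec(1) homog_part_spec(1), of i x j y]
    by (simp only:)
  then show "br x y = bihom_bracket scale V m \<alpha> \<beta> x y"
    unfolding expand[OF br] expand[OF bihom_bracket_bilinear[OF assms(1,2)]] by simp
qed

end

end

theory Submission
  imports Defs
begin

text \<open>Since \<open>\<alpha>\<close> and \<open>\<beta>\<close> are invertible, the product can be untwisted:
  $x \cdot y = \alpha^{-1}(x)\,\beta^{-1}(y)$ is an ordinary associative product for which \<open>\<alpha>\<close>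
  and \<open>\<beta>\<close> are multiplicative, and $xy = \alpha(x) \cdot \beta(y)$. The bracket becomes
  $[x,y] = \langle\alpha(x), \beta(y)\rangle$ with the supercommutator of the untwisted product, and
  $[\beta^2(x), [\beta(y), \alpha(z)]] = \langle X, \langle Y, Z\rangle\rangle$ for
  $X = \alpha\beta^2(x)$, $Y = \alpha\beta^2(y)$, $Z = \alpha\beta^2(z)$, so the BiHom-Jacobi
  identity is the ordinary super Jacobi identity of a supercommutator.\<close>

context superspace
begin

text \<open>An even map commutes with taking the component of parity \<open>i\<close>. So if
  \<open>f y\<close> is homogeneous of parity \<open>i\<close>, then \<open>y\<close> and its
  component of parity \<open>i\<close> have the same image, and injectivity identifies them.\<close>

lemma inv_mem_part:
  assumes f: "even_linear scale V f" and "bij f" and x: "x \<in> V i"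
  shows "inv f x \<in> V i"
proof -
  define y where "y = inv f x"
  have fy: "f y = x"
    using \<open>bij f\<close> by (simp add: y_def bij_is_surj surj_f_inv_f)
  interpret f: Vector_Spaces.linear scale scale f
    using f by (simp add: even_linear_def)
  have part: "f u \<in> V j" if "u \<in> V j" for u j
    using f that by (simp add: even_linear_def)
  have "homog_part V i (f y) = f (homog_part V i y)"
    using part[OF homog_part_spec(1)] part[OF homog_part_spec(2)[where i = i and x = y]]
    by (intro homog_part_eqI) (simp_all add: f.diff)
  then have "f (homog_part V i y) = f y"
    using x by (simp add: fy homog_part_homog)
  then have "homog_part V i y = y"
    using \<open>bij f\<close> by (metis bij_is_inj injD)
  then show ?thesis
    using homog_part_spec(1)[where i = i and x = y] by (simp add: y_def)
qed

end

locale regular_bihom_associative_superalgebra =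
  bihom_associative_superalgebra scale V m \<alpha> \<beta>
  for scale :: "'k::field \<Rightarrow> 'v::ab_group_add \<Rightarrow> 'v" and V :: "bit \<Rightarrow> 'v set"
    and m :: "'v \<Rightarrow> 'v \<Rightarrow> 'v" and \<alpha> \<beta> :: "'v \<Rightarrow> 'v" +
  assumes bij_\<alpha>: "bij \<alpha>" and bij_\<beta>: "bij \<beta>"
begin

definition untwist :: "'v \<Rightarrow> 'v \<Rightarrow> 'v" (infixl "\<cdot>" 70)
  where "x \<cdot> y = m (inv \<alpha> x) (inv \<beta> y)"

abbreviation br :: "'v \<Rightarrow> 'v \<Rightarrow> 'v"
  where "br \<equiv> bihom_bracket scale V m \<alpha> \<beta>"

lemma inv_simps [simp]:
  "\<alpha> (inv \<alpha> x) = x" "inv \<alpha> (\<alpha> x) = x" "\<beta> (inv \<beta> x) = x" "inv \<beta> (\<beta> x) = x"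
  using bij_\<alpha> bij_\<beta> by (simp_all add: bij_is_inj bij_is_surj surj_f_inv_f)

text \<open>Used as a rewrite rule, this brings mixed composites to a normal form with \<alpha>
  outermost; the two rules after it move inverses outwards.\<close>

lemma \<beta>_\<alpha>: "\<beta> (\<alpha> x) = \<alpha> (\<beta> x)"
  using commute by (metis comp_apply)

lemma \<beta>_inv_\<alpha>: "\<beta> (inv \<alpha> x) = inv \<alpha> (\<beta> x)"
  by (metis \<beta>_\<alpha> inv_simps(1,2))

lemma \<alpha>_inv_\<beta>: "\<alpha> (inv \<beta> x) = inv \<beta> (\<alpha> x)"
  by (metis \<beta>_\<alpha> inv_simps(3,4))

lemma part_closed:
  assumes "x \<in> V i"
  shows "\<alpha> x \<in> V i" "\<beta> x \<in> V i" "inv \<alpha> x \<in> V i" "inv \<beta> x \<in> V i"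
  using assms even_\<alpha> even_\<beta> inv_mem_part bij_\<alpha> bij_\<beta> by (auto simp: even_linear_def)

lemma m_part: "x \<in> V i \<Longrightarrow> y \<in> V j \<Longrightarrow> m x y \<in> V (i + j)"
  using even_m by (simp add: even_bilinear_def)

lemma linear_structure:
  shows \<alpha>_diff: "\<alpha> (x - y) = \<alpha> x - \<alpha> y" and \<alpha>_scale: "\<alpha> (scale c x) = scale c (\<alpha> x)"
    and \<beta>_diff: "\<beta> (x - y) = \<beta> x - \<beta> y" and \<beta>_scale: "\<beta> (scale c x) = scale c (\<beta> x)"
proof -
  interpret A: Vector_Spaces.linear scale scale \<alpha> using even_\<alpha> by (simp add: even_linear_def)
  interpret B: Vector_Spaces.linear scale scale \<beta> using even_\<beta> by (simp add: even_linear_def)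
  show "\<alpha> (x - y) = \<alpha> x - \<alpha> y" "\<alpha> (scale c x) = scale c (\<alpha> x)"
    "\<beta> (x - y) = \<beta> x - \<beta> y" "\<beta> (scale c x) = scale c (\<beta> x)"
    by (simp_all add: A.diff A.scale B.diff B.scale)
qed

lemma untwist_part: "x \<in> V i \<Longrightarrow> y \<in> V j \<Longrightarrow> x \<cdot> y \<in> V (i + j)"
  unfolding untwist_def by (intro m_part part_closed)

lemma untwist_bilinear:
  "x \<cdot> (y + z) = x \<cdot> y + x \<cdot> z" "(x + y) \<cdot> z = x \<cdot> z + y \<cdot> z"
  "x \<cdot> (y - z) = x \<cdot> y - x \<cdot> z" "(x - y) \<cdot> z = x \<cdot> z - y \<cdot> z"
  "x \<cdot> scale c y = scale c (x \<cdot> y)" "scale c x \<cdot> y = scale c (x \<cdot> y)"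
proof -
  have "Vector_Spaces.linear scale scale (inv \<alpha>)" "Vector_Spaces.linear scale scale (inv \<beta>)"
    using linear_inv even_\<alpha> even_\<beta> bij_\<alpha> bij_\<beta> by (auto simp: even_linear_def)
  moreover have "\<And>x. Vector_Spaces.linear scale scale (\<lambda>y. m x y)"
    "\<And>y. Vector_Spaces.linear scale scale (\<lambda>x. m x y)"
    using even_m by (auto simp: even_bilinear_def bilinear_op_def)
  ultimately have r: "Vector_Spaces.linear scale scale (\<lambda>y. x \<cdot> y)"
    and l: "Vector_Spaces.linear scale scale (\<lambda>x. x \<cdot> y)" for x y
    unfolding linear_iff_rules untwist_def by simp_all
  interpret r: Vector_Spaces.linear scale scale "\<lambda>y. x \<cdot> y" for x by (rule r)
  interpret l: Vector_Spaces.linear scale scale "\<lambda>x. x \<cdot> y" for y by (rule l)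
  show "x \<cdot> (y + z) = x \<cdot> y + x \<cdot> z" "(x + y) \<cdot> z = x \<cdot> z + y \<cdot> z"
    "x \<cdot> (y - z) = x \<cdot> y - x \<cdot> z" "(x - y) \<cdot> z = x \<cdot> z - y \<cdot> z"
    "x \<cdot> scale c y = scale c (x \<cdot> y)" "scale c x \<cdot> y = scale c (x \<cdot> y)"
    by (simp_all add: r.add l.add r.diff l.diff r.scale l.scale)
qed

lemma \<alpha>_untwist: "x \<in> V i \<Longrightarrow> y \<in> V j \<Longrightarrow> \<alpha> (x \<cdot> y) = \<alpha> x \<cdot> \<alpha> y"
  by (simp add: untwist_def \<alpha>_mult[of _ i _ j] part_closed \<alpha>_inv_\<beta>)

lemma \<beta>_untwist: "x \<in> V i \<Longrightarrow> y \<in> V j \<Longrightarrow> \<beta> (x \<cdot> y) = \<beta> x \<cdot> \<beta> y"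
  by (simp add: untwist_def \<beta>_mult[of _ i _ j] part_closed \<beta>_inv_\<alpha>)

lemma untwist_assoc:
  assumes "x \<in> V i" "y \<in> V j" "z \<in> V l"
  shows "(x \<cdot> y) \<cdot> z = x \<cdot> (y \<cdot> z)"
proof -
  \<comment> \<open>The arguments are chosen so that \<open>m (\<alpha> ?x) (m ?y ?z)\<close> is
    \<open>x \<cdot> (y \<cdot> z)\<close> and \<open>m (m ?x ?y) (\<beta> ?z)\<close> is
    \<open>(x \<cdot> y) \<cdot> z\<close>. The middle one carries both inverses, as it is a right
    factor in one inner product and a left factor in the other.\<close>
  let ?x = "inv \<alpha> (inv \<alpha> x)" and ?y = "inv \<alpha> (inv \<beta> y)" and ?z = "inv \<beta> (inv \<beta> z)"
  have mem: "?x \<in> V i" "?y \<in> V j" "?z \<in> V l"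
    using assms by (simp_all add: part_closed)
  have "x \<cdot> y = \<alpha> (m ?x ?y)"
    using \<alpha>_mult[OF mem(1,2)] by (simp add: untwist_def)
  moreover have "y \<cdot> z = \<beta> (m ?y ?z)"
    using \<beta>_mult[OF mem(2,3)] by (simp add: untwist_def \<beta>_inv_\<alpha>)
  ultimately show ?thesis
    using bihom_assoc[OF mem] by (simp add: untwist_def)
qed

text \<open>The parities are explicit arguments because they are not a function of the vectors: zero
  has both, and an inhomogeneous vector has none.\<close>

definition scomm :: "bit \<Rightarrow> bit \<Rightarrow> 'v \<Rightarrow> 'v \<Rightarrow> 'v"
  where "scomm i j x y = x \<cdot> y - scale (sgn_parity (i * j)) (y \<cdot> x)"

lemma br_eq_scomm:
  assumes "x \<in> V i" "y \<in> V j"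
  shows "br x y = scomm i j (\<alpha> x) (\<beta> y)"
  by (simp add: bihom_bracket_homog[OF bij_\<alpha> bij_\<beta> assms] scomm_def untwist_def \<alpha>_inv_\<beta>)

lemma scomm_part:
  assumes "x \<in> V i" "y \<in> V j"
  shows "scomm i j x y \<in> V (i + j)"
  unfolding scomm_def
  using untwist_part[OF assms] untwist_part[OF assms(2,1)]
  \<comment> \<open>The swapped product lands in \<open>V (j + i)\<close>, which has to be
    recognised as \<open>V (i + j)\<close>.\<close>
  by (auto simp: add.commute[of j] intro!: subspace_diff subspace_scale subspace_part)

lemma \<alpha>_scomm: "x \<in> V i \<Longrightarrow> y \<in> V j \<Longrightarrow> \<alpha> (scomm i j x y) = scomm i j (\<alpha> x) (\<alpha> y)"
  by (simp add: scomm_def \<alpha>_diff \<alpha>_scale \<alpha>_untwist[of _ i _ j] \<alpha>_untwist[of _ j _ i])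

lemma \<beta>_scomm: "x \<in> V i \<Longrightarrow> y \<in> V j \<Longrightarrow> \<beta> (scomm i j x y) = scomm i j (\<beta> x) (\<beta> y)"
  by (simp add: scomm_def \<beta>_diff \<beta>_scale \<beta>_untwist[of _ i _ j] \<beta>_untwist[of _ j _ i])

text \<open>Only the sign matters: it is symmetric in the parities and squares to 1, so homogeneity
  is not assumed.\<close>

lemma scomm_skew: "scomm i j x y = - scale (sgn_parity (i * j)) (scomm j i y x)"
  by (cases i; cases j) (simp_all add: scomm_def sgn_parity_def scale_right_diff_distrib)

text \<open>The expansion has twelve triple products. By associativity each of the six orderings of
  \<open>x\<close>, \<open>y\<close>, \<open>z\<close> occurs twice, and the two occurrences cancel;
  the signs are checked for all eight parity triples.\<close>

lemma scomm_jacobi: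
  assumes "x \<in> V i" "y \<in> V j" "z \<in> V l"
  shows "scale (sgn_parity (i * l)) (scomm i (j + l) x (scomm j l y z)) +
    scale (sgn_parity (j * i)) (scomm j (l + i) y (scomm l i z x)) +
    scale (sgn_parity (l * j)) (scomm l (i + j) z (scomm i j x y)) = 0"
  by (cases i; cases j; cases l)
    (simp_all add: scomm_def sgn_parity_def untwist_bilinear scale_right_diff_distrib
      untwist_assoc[OF assms(1,2,3)] untwist_assoc[OF assms(1,3,2)]
      untwist_assoc[OF assms(2,1,3)] untwist_assoc[OF assms(2,3,1)]
      untwist_assoc[OF assms(3,1,2)] untwist_assoc[OF assms(3,2,1)])

lemma br_part: "x \<in> V i \<Longrightarrow> y \<in> V j \<Longrightarrow> br x y \<in> V (i + j)"
  using scomm_part[OF part_closed(1) part_closed(2)] by (simp only: br_eq_scomm)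

lemma br_br_eq_scomm:
  assumes "x \<in> V i" "y \<in> V j" "z \<in> V l"
  shows "br (\<beta> (\<beta> x)) (br (\<beta> y) (\<alpha> z)) =
    scomm i (j + l) (\<alpha> (\<beta> (\<beta> x))) (scomm j l (\<alpha> (\<beta> (\<beta> y))) (\<alpha> (\<beta> (\<beta> z))))"
proof -
  have "br (\<beta> y) (\<alpha> z) = scomm j l (\<alpha> (\<beta> y)) (\<alpha> (\<beta> z))"
    using assms by (simp add: br_eq_scomm[of _ j _ l] part_closed \<beta>_\<alpha>)
  \<comment> \<open>The outer bracket puts one more \<beta> on the inner supercommutator.
    Distributing it gives all three arguments the same twist, which is what lets the cyclic sum
    carry over.\<close>
  moreover have "br (\<beta> (\<beta> x)) (scomm j l (\<alpha> (\<beta> y)) (\<alpha> (\<beta> z))) =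
      scomm i (j + l) (\<alpha> (\<beta> (\<beta> x))) (\<beta> (scomm j l (\<alpha> (\<beta> y)) (\<alpha> (\<beta> z))))"
    using assms by (intro br_eq_scomm scomm_part part_closed)
  moreover have "\<beta> (scomm j l (\<alpha> (\<beta> y)) (\<alpha> (\<beta> z))) =
      scomm j l (\<alpha> (\<beta> (\<beta> y))) (\<alpha> (\<beta> (\<beta> z)))"
    using assms by (simp add: \<beta>_scomm part_closed \<beta>_\<alpha>)
  ultimately show ?thesis
    by (simp only:)
qed

lemma bihom_lie: "bihom_lie_superalgebra scale V br \<alpha> \<beta>"
proof unfold_locales
  show "even_linear scale V \<alpha>" "even_linear scale V \<beta>" "\<alpha> \<circ> \<beta> = \<beta> \<circ> \<alpha>"
    by (fact even_\<alpha> even_\<beta> commute)+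
  show "even_bilinear scale V br"
    unfolding even_bilinear_def
    using bihom_bracket_bilinear[OF bij_\<alpha> bij_\<beta>] br_part by blast
next
  fix i j x y assume "x \<in> V i" "y \<in> V j"
  then show "\<alpha> (br x y) = br (\<alpha> x) (\<alpha> y)" "\<beta> (br x y) = br (\<beta> x) (\<beta> y)"
    by (simp_all add: br_eq_scomm[of _ i _ j] part_closed \<alpha>_scomm \<beta>_scomm \<beta>_\<alpha>)
next
  fix i j x y assume "x \<in> V i" "y \<in> V j"
  then show "br (\<beta> x) (\<alpha> y) = - scale (sgn_parity (i * j)) (br (\<beta> y) (\<alpha> x))"
    \<comment> \<open>Both brackets are supercommutators of the same two elements,
      \<alpha>(\<beta>(x)) and \<alpha>(\<beta>(y)), in opposite orders.\<close>
    using scomm_skew[of i j "\<alpha> (\<beta> x)" "\<alpha> (\<beta> y)"]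
    by (simp add: br_eq_scomm[of _ i _ j] br_eq_scomm[of _ j _ i] part_closed \<beta>_\<alpha>)
next
  fix i j l x y z assume "x \<in> V i" "y \<in> V j" "z \<in> V l"
  then show "scale (sgn_parity (i * l)) (br (\<beta> (\<beta> x)) (br (\<beta> y) (\<alpha> z))) +
      scale (sgn_parity (j * i)) (br (\<beta> (\<beta> y)) (br (\<beta> z) (\<alpha> x))) +
      scale (sgn_parity (l * j)) (br (\<beta> (\<beta> z)) (br (\<beta> x) (\<alpha> y))) = 0"
    by (simp only: br_br_eq_scomm) (intro scomm_jacobi part_closed)
qed

end

theorem theorem2p6:
  fixes scale :: "'k::field \<Rightarrow> 'v::ab_group_add \<Rightarrow> 'v"
    and V :: "bit \<Rightarrow> 'v set"
    and m :: "'v \<Rightarrow> 'v \<Rightarrow> 'v"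
    and \<alpha> \<beta> :: "'v \<Rightarrow> 'v"
  assumes "bihom_associative_superalgebra scale V m \<alpha> \<beta>"
    and "bij \<alpha>"
    and "bij \<beta>"
  shows "bihom_lie_superalgebra scale V (bihom_bracket scale V m \<alpha> \<beta>) \<alpha> \<beta>"
  using assms
  by (intro regular_bihom_associative_superalgebra.bihom_lie
      regular_bihom_associative_superalgebra.intro
      regular_bihom_associative_superalgebra_axioms.intro)

end
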